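(* Let $T$ be a rotational tournament on $n>3$ vertices with symbol $S$. Then $T$ is quadrangular if and only if for every integer $m$ with $1\leq m\leq \frac{n-1}{2}$ there exist distinct two-element subsets $\{i,j\},\{k,l\}\subseteq S$ such that $i-j\equiv k-l\equiv m \pmod{n}$.
   Context: Let $n=2r+1$ and let $S$ be a set of $r$ integers in $\{1,\dots,2r\}$ such that $a+b\neq 2r+1$ for all $a,b\in S$. The rotational tournament with symbol $S$ has vertices $0,1,\dots,2r$ and an arc $a\rightarrow b$ iff $b-a \pmod{n}\in S$. $O(v)$ is the set of vertices $v$ beats and $I(v)$ the set of vertices beating $v$. A digraph is quadrangular if for all distinct $u,v$, $|O(u)\cap O(v)|\neq 1$ and $|I(u)\cap I(v)|\neq 1$. *)

theory Defs
  imports "Graph_Theory.Pair_Digraph" "HOL-Number_Theory.Cong"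
begin

definition out_set :: "('a, 'b) pre_digraph \<Rightarrow> 'a \<Rightarrow> 'a set" where
  "out_set G v = {w \<in> verts G. v \<rightarrow>\<^bsub>G\<^esub> w}"

definition in_set :: "('a, 'b) pre_digraph \<Rightarrow> 'a \<Rightarrow> 'a set" where
  "in_set G v = {w \<in> verts G. w \<rightarrow>\<^bsub>G\<^esub> v}"

text \<open>Intended for finite digraphs: \<open>card\<close> of an infinite set is \<open>0\<close>.\<close>

definition quadrangular :: "('a, 'b) pre_digraph \<Rightarrow> bool" where
  "quadrangular G \<longleftrightarrow>
     (\<forall>u\<in>verts G. \<forall>v\<in>verts G. u \<noteq> v \<longrightarrow>
        card (out_set G u \<inter> out_set G v) \<noteq> 1 \<and>
        card (in_set G u \<inter> in_set G v) \<noteq> 1)"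

definition rotational_symbol :: "nat \<Rightarrow> int set \<Rightarrow> bool" where
  "rotational_symbol r S \<longleftrightarrow>
     S \<subseteq> {1..2 * int r} \<and> card S = r \<and> (\<forall>a\<in>S. \<forall>b\<in>S. a + b \<noteq> 2 * int r + 1)"

text \<open>On \<^typ>\<open>int\<close>, \<open>(b - a) mod (2 * int r + 1)\<close> is the residue in \<open>{0..2 * int r}\<close>.\<close>

definition rotational_tournament :: "nat \<Rightarrow> int set \<Rightarrow> int pair_pre_digraph" where
  "rotational_tournament r S =
     \<lparr> pverts = {0..2 * int r},
       parcs = {(a, b). a \<in> {0..2 * int r} \<and> b \<in> {0..2 * int r} \<and>
                        (b - a) mod (2 * int r + 1) \<in> S} \<rparr>"

end

theory Submission
  imports Defs
begin

text \<open>
  Both \<open>O(u) \<inter> O(v)\<close> and \<open>I(u) \<inter> I(v)\<close> are in bijection with the set \<open>D(d)\<close> of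
  pairs in \<open>S\<close> with difference \<open>d = \<plusminus>(v - u)\<close>, so quadrangularity says that \<open>|D(d)| \<noteq> 1\<close> for
  all \<open>d \<noteq> 0\<close>, while the right-hand side says that \<open>|D(d)| \<ge> 2\<close>. The point is thus to exclude
  \<open>D(m) = \<emptyset>\<close>. As \<open>S\<close> contains exactly one of \<open>x\<close>, \<open>-x\<close> for each \<open>x \<noteq> 0\<close>, we may take \<open>m \<in> S\<close>.
  If \<open>D(m) = \<emptyset>\<close>, then \<open>i \<in> S\<close> gives \<open>-i - m \<in> S\<close>, and \<open>m - i \<in> S\<close> unless \<open>i = m\<close>; hence
  \<open>i - 2m \<in> S\<close> for every \<open>i \<in> S - {m}\<close>. Consequently \<open>i - 3m \<notin> S\<close> for these \<open>i\<close>, whereas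
  \<open>m - 3m = -2m \<in> S\<close>, so \<open>|D(-3m)| = 1\<close>. Finally \<open>3m \<noteq> 0\<close>, because \<open>S\<close> has an
  element \<open>i \<noteq> m\<close>.
\<close>

text \<open>A pair \<open>(i, j)\<close> in \<open>D(d)\<close>, \<open>i - j \<equiv> d\<close>, is encoded by \<open>j\<close> alone.\<close>

definition diff_starts :: "int \<Rightarrow> int set \<Rightarrow> int \<Rightarrow> int set" where
  "diff_starts n S d = {j \<in> S. (j + d) mod n \<in> S}"

locale rotational =
  fixes r :: nat and n :: int and S :: "int set"
  assumes n_def: "n = 2 * int r + 1" and symbol: "rotational_symbol r S"
begin

section \<open>The symbol as a half-system of nonzero residues\<close>

lemma n_pos: "n > 0"
  using n_def by simp

lemma symbol_bounds: "x \<in> S \<Longrightarrow> 0 < x \<and> x < n"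
  using symbol n_def by (force simp: rotational_symbol_def)

lemma symbol_mod: "x \<in> S \<Longrightarrow> x mod n = x"
  using symbol_bounds by force

lemma finite_symbol: "finite S"
  using symbol finite_subset by (auto simp: rotational_symbol_def)

lemma card_symbol: "card S = r"
  using symbol by (simp add: rotational_symbol_def)

lemma symbol_not_dvd: "x mod n \<in> S \<Longrightarrow> \<not> n dvd x"
  using symbol_bounds[of "x mod n"] by auto

lemma mod_uminus: "\<not> n dvd x \<Longrightarrow> (- x) mod n = n - x mod n"
  by (simp add: zmod_zminus1_eq_if mod_eq_0_iff_dvd)

lemma mod_pos: "\<not> n dvd x \<Longrightarrow> 0 < x mod n"
  using pos_mod_sign[OF n_pos, of x] mod_0_imp_dvd[of x n] by linarith

lemma symbol_uminus_notin:
  assumes "x mod n \<in> S" shows "(- x) mod n \<notin> S"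
proof
  assume *: "(- x) mod n \<in> S"
  have "(- x) mod n = n - x mod n"
    using symbol_not_dvd[OF assms] by (rule mod_uminus)
  then show False
    using assms * symbol n_def unfolding rotational_symbol_def
    by (metis add.commute diff_add_cancel)
qed

text \<open>By counting: \<open>S\<close> and its reflection under a -> n - a are disjoint and have
  r elements each, so together they exhaust {1..2r}.\<close>

lemma symbol_or_uminus:
  assumes "\<not> n dvd x" shows "x mod n \<in> S \<or> (- x) mod n \<in> S"
proof -
  have disj: "S \<inter> (\<lambda>a. n - a) ` S = {}"
    using symbol n_def unfolding rotational_symbol_def by fastforce
  have card: "card ((\<lambda>a. n - a) ` S) = r"
    by (subst card_image) (auto simp: card_symbol inj_on_def)
  have "S \<union> (\<lambda>a. n - a) ` S = {1..2 * int r}"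
  proof (rule card_subset_eq)
    show "S \<union> (\<lambda>a. n - a) ` S \<subseteq> {1..2 * int r}"
      using symbol_bounds n_def by fastforce
    show "card (S \<union> (\<lambda>a. n - a) ` S) = card {1..2 * int r}"
      using card_Un_disjoint[OF finite_symbol finite_imageI[OF finite_symbol] disj] card
      by (simp add: card_symbol)
  qed simp
  moreover have "x mod n \<in> {1..2 * int r}"
    using mod_pos[OF assms] pos_mod_bound[OF n_pos, of x] n_def
    unfolding atLeastAtMost_iff by linarith
  ultimately consider "x mod n \<in> S" | a where "a \<in> S" "x mod n = n - a"
    by blast
  then show ?thesis
  proof cases
    case 2
    with mod_uminus[OF assms] show ?thesis by simp
  qed simp
qed

section \<open>The difference sets D(d)\<close>

lemma finite_diff_starts: "finite (diff_starts n S d)"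
  using finite_symbol by (simp add: diff_starts_def)

lemma diff_starts_mod: "diff_starts n S (d mod n) = diff_starts n S d"
  by (simp add: diff_starts_def mod_simps)

text \<open>Swapping the two entries of a pair negates its difference; in the encoding, the second
  entry is exchanged for the first.\<close>

lemma card_diff_starts_uminus: "card (diff_starts n S (- d)) = card (diff_starts n S d)"
proof (rule bij_betw_same_card)
  show "bij_betw (\<lambda>j. (j - d) mod n) (diff_starts n S (- d)) (diff_starts n S d)"
    by (rule bij_betw_byWitness[where f' = "\<lambda>j. (j + d) mod n"])
      (auto simp: diff_starts_def mod_simps symbol_mod)
qed

section \<open>Common neighbours as difference sets\<close>

abbreviation tournament where
  "tournament \<equiv> with_proj (rotational_tournament r S)"

lemma verts_tournament: "verts tournament = {0..<n}"
  using n_def by (auto simp: rotational_tournament_def)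

lemma dominates_tournament:
  "a \<rightarrow>\<^bsub>tournament\<^esub> b \<longleftrightarrow> a \<in> {0..<n} \<and> b \<in> {0..<n} \<and> (b - a) mod n \<in> S"
  using n_def by (auto simp: rotational_tournament_def arcs_ends_conv)

lemma out_set_tournament:
  "u \<in> {0..<n} \<Longrightarrow> out_set tournament u = {w \<in> {0..<n}. (w - u) mod n \<in> S}"
  unfolding out_set_def verts_tournament dominates_tournament by auto

lemma in_set_tournament:
  "u \<in> {0..<n} \<Longrightarrow> in_set tournament u = {w \<in> {0..<n}. (u - w) mod n \<in> S}"
  unfolding in_set_def verts_tournament dominates_tournament by auto

text \<open>A common out-neighbour w yields the pair (w - u, w - v) in \<open>S\<close>, whose
  difference v - u does not depend on w.\<close>

lemma card_common_out:
  assumes "u \<in> {0..<n}" "v \<in> {0..<n}"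
  shows "card (out_set tournament u \<inter> out_set tournament v) = card (diff_starts n S (v - u))"
proof (rule bij_betw_same_card)
  have "((w - v) mod n + (v - u)) mod n = (w - u) mod n"
    "((j + v) mod n - u) mod n = (j + (v - u)) mod n" for w j
    unfolding mod_add_left_eq mod_diff_left_eq by (simp_all add: algebra_simps)
  then show "bij_betw (\<lambda>w. (w - v) mod n) (out_set tournament u \<inter> out_set tournament v)
    (diff_starts n S (v - u))"
    unfolding out_set_tournament[OF assms(1)] out_set_tournament[OF assms(2)] diff_starts_def
    by (intro bij_betw_byWitness[where f' = "\<lambda>j. (j + v) mod n"])
      (use n_pos in \<open>auto simp: mod_simps symbol_mod\<close>)
qed

text \<open>Here the pair is (u - w, v - w), so the difference has the opposite sign.\<close>

lemma card_common_in:
  assumes "u \<in> {0..<n}" "v \<in> {0..<n}"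
  shows "card (in_set tournament u \<inter> in_set tournament v) = card (diff_starts n S (u - v))"
proof (rule bij_betw_same_card)
  have "((v - w) mod n + (u - v)) mod n = (u - w) mod n"
    "(u - (v - j) mod n) mod n = (j + (u - v)) mod n" for w j
    unfolding mod_add_left_eq mod_diff_right_eq by (simp_all add: algebra_simps)
  then show "bij_betw (\<lambda>w. (v - w) mod n) (in_set tournament u \<inter> in_set tournament v)
    (diff_starts n S (u - v))"
    unfolding in_set_tournament[OF assms(1)] in_set_tournament[OF assms(2)] diff_starts_def
    by (intro bij_betw_byWitness[where f' = "\<lambda>j. (v - j) mod n"])
      (use n_pos in \<open>auto simp: mod_simps symbol_mod\<close>)
qed

lemma quadrangular_iff:
  "quadrangular tournament \<longleftrightarrow> (\<forall>d. \<not> n dvd d \<longrightarrow> card (diff_starts n S d) \<noteq> 1)"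
proof
  assume quad: "quadrangular tournament"
  show "\<forall>d. \<not> n dvd d \<longrightarrow> card (diff_starts n S d) \<noteq> 1"
  proof (intro allI impI)
    fix d assume "\<not> n dvd d"
    \<comment> \<open>The vertices 0 and \<open>d mod n\<close> realise the difference d.\<close>
    then have "d mod n \<in> {0..<n}" "0 \<in> {0..<n}" "d mod n \<noteq> 0"
      using n_pos mod_pos[of d] by auto
    then show "card (diff_starts n S d) \<noteq> 1"
      using quad card_common_out[of 0 "d mod n"]
      unfolding quadrangular_def verts_tournament by (metis diff_zero diff_starts_mod)
  qed
next
  assume *: "\<forall>d. \<not> n dvd d \<longrightarrow> card (diff_starts n S d) \<noteq> 1"
  have "\<not> n dvd u - v" if "u \<in> {0..<n}" "v \<in> {0..<n}" "u \<noteq> v" for u v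
    using that by (metis atLeastLessThan_iff mod_eq_dvd_iff mod_pos_pos_trivial)
  then show "quadrangular tournament"
    unfolding quadrangular_def verts_tournament using * card_common_out card_common_in by metis
qed

section \<open>Excluding empty difference sets\<close>

lemma diff_starts_empty_imp_singleton:
  assumes "r > 1" "m mod n \<in> S" and empty: "diff_starts n S m = {}"
  shows "\<exists>d. \<not> n dvd d \<and> card (diff_starts n S d) = 1"
proof -
  have plus: "(i + m) mod n \<notin> S" if "i mod n \<in> S" for i
    using that empty by (auto simp: diff_starts_def mod_simps)
  have minus: "(i - m) mod n \<notin> S" if "i mod n \<in> S" for i
    using plus[of "i - m"] that by auto
  have neg: "(- i - m) mod n \<in> S" if "i mod n \<in> S" for i
  proof -
    \<comment> \<open>Otherwise i would be congruent to -m, and \<open>S\<close> would contain the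
      residues of both m and -m.\<close>
    have "\<not> n dvd i + m"
      using symbol_uminus_notin[OF assms(2)] that
      by (metis add.commute diff_minus_eq_add dvd_diff_commute mod_eq_dvd_iff)
    then show ?thesis
      using symbol_or_uminus[of "i + m"] plus[OF that] by simp
  qed
  have step: "(i - 2 * m) mod n \<in> S" if "i \<in> S" "i \<noteq> m mod n" for i
  proof -
    have "\<not> n dvd i - m"
      using that by (metis mod_eq_dvd_iff symbol_mod)
    then have "(m - i) mod n \<in> S"
      using symbol_or_uminus[of "i - m"] minus[of i] that symbol_mod by auto
    from neg[OF this] show ?thesis by (simp add: algebra_simps)
  qed
  have "\<not> n dvd - 3 * m"
  proof
    assume dvd: "n dvd - 3 * m"
    obtain i where i: "i \<in> S" "i \<noteq> m mod n"
      using \<open>r > 1\<close> card_symbol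
      by (metis card_le_Suc0_iff_eq finite_symbol leD One_nat_def)
    \<comment> \<open>Once 3m vanishes mod n, \<open>step\<close> puts this residue into
      \<open>S\<close> while \<open>plus\<close> keeps it out.\<close>
    have "(i - 2 * m) mod n = (i + m) mod n"
      using dvd by (simp add: mod_eq_dvd_iff)
    with step[OF i] plus[of i] i symbol_mod show False by simp
  qed
  moreover have "diff_starts n S (- 3 * m) = {m mod n}"
  proof (intro equalityI subsetI)
    fix j assume "j \<in> diff_starts n S (- 3 * m)"
    then have j: "j \<in> S" "(j - 3 * m) mod n \<in> S"
      by (auto simp: diff_starts_def)
    have "j = m mod n"
    proof (rule ccontr)
      assume "j \<noteq> m mod n"
      from minus[OF step[OF j(1) this]] j(2) show False
        by (simp add: algebra_simps)
    qed
    then show "j \<in> {m mod n}" by simp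
  next
    fix j assume "j \<in> {m mod n}"
    moreover have "(m mod n + - 3 * m) mod n = (- m - m) mod n"
      unfolding mod_add_left_eq by simp
    ultimately show "j \<in> diff_starts n S (- 3 * m)"
      using neg[OF assms(2)] assms(2) by (simp add: diff_starts_def)
  qed
  ultimately show ?thesis
    by (intro exI[of _ "- 3 * m"]) simp
qed

lemma quadrangular_iff_card_ge_2:
  assumes "r > 1"
  shows "quadrangular tournament \<longleftrightarrow>
    (\<forall>m. 1 \<le> m \<and> m \<le> int r \<longrightarrow> 2 \<le> card (diff_starts n S m))"
proof
  assume quad: "quadrangular tournament"
  show "\<forall>m. 1 \<le> m \<and> m \<le> int r \<longrightarrow> 2 \<le> card (diff_starts n S m)"
  proof (intro allI impI)
    fix m assume m: "1 \<le> m \<and> m \<le> int r"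
    then have ndvd: "\<not> n dvd m"
      using n_def zdvd_imp_le by fastforce
    have "card (diff_starts n S m) \<noteq> 0"
    proof
      assume "card (diff_starts n S m) = 0"
      \<comment> \<open>Both signs are recorded because only one of m, -m has its residue in
        \<open>S\<close>, and it is not known which.\<close>
      then have "diff_starts n S m = {}" "diff_starts n S (- m) = {}"
        using card_diff_starts_uminus[of m] finite_diff_starts by auto
      then show False
        using symbol_or_uminus[OF ndvd] diff_starts_empty_imp_singleton[OF assms] quad
        unfolding quadrangular_iff by blast
    qed
    moreover have "card (diff_starts n S m) \<noteq> 1"
      using quad ndvd quadrangular_iff by blast
    ultimately show "2 \<le> card (diff_starts n S m)" by linarith
  qed
next
  assume *: "\<forall>m. 1 \<le> m \<and> m \<le> int r \<longrightarrow> 2 \<le> card (diff_starts n S m)"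
  have "card (diff_starts n S d) \<noteq> 1" if "\<not> n dvd d" for d
  proof (cases "d mod n \<le> int r")
    case True
    moreover have "1 \<le> d mod n"
      using mod_pos[OF that] by linarith
    ultimately show ?thesis
      using *[rule_format, of "d mod n"] by (simp add: diff_starts_mod)
  next
    case False
    \<comment> \<open>A residue above r is reflected into the range 1..r, which preserves the size
      of D(d).\<close>
    have "1 \<le> (- d) mod n" "(- d) mod n \<le> int r"
      using mod_uminus[OF that] False n_def pos_mod_bound[OF n_pos, of d] by linarith+
    then show ?thesis
      using *[rule_format, of "(- d) mod n"]
      by (simp add: diff_starts_mod card_diff_starts_uminus)
  qed
  then show "quadrangular tournament"
    using quadrangular_iff by blast
qed

section \<open>From ordered pairs to two-element subsets\<close>

lemma card_diff_starts_ge_2_iff: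
  assumes "\<not> n dvd m"
  shows "2 \<le> card (diff_starts n S m) \<longleftrightarrow>
    (\<exists>i j k l. {i, j} \<subseteq> S \<and> {k, l} \<subseteq> S \<and>
       card {i, j} = 2 \<and> card {k, l} = 2 \<and> {i, j} \<noteq> {k, l} \<and>
       [i - j = k - l] (mod n) \<and> [k - l = m] (mod n))"
  (is "_ \<longleftrightarrow> ?R")
proof
  assume "2 \<le> card (diff_starts n S m)"
  then obtain j l where jl: "j \<in> diff_starts n S m" "l \<in> diff_starts n S m" "j \<noteq> l"
    using card_le_Suc0_iff_eq[OF finite_diff_starts, of m] by fastforce
  define i k where "i = (j + m) mod n" and "k = (l + m) mod n"
  have S: "i \<in> S" "j \<in> S" "k \<in> S" "l \<in> S"
    using jl by (auto simp: i_def k_def diff_starts_def)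
  have im: "[i - j = m] (mod n)" and km: "[k - l = m] (mod n)"
    by (auto simp: i_def k_def cong_def mod_simps)
  have "i \<noteq> j" "k \<noteq> l"
    using im km assms by (auto simp: cong_0_iff dest: cong_sym)
  \<comment> \<open>Distinct ordered pairs could still give the same set by being reversed; then 2m
    would vanish mod n, impossible for odd n.\<close>
  moreover have "\<not> (i = l \<and> j = k)"
  proof
    assume "i = l \<and> j = k"
    then have "[m + m = 0] (mod n)"
      using cong_add[OF im km] by (simp add: cong_sym_eq)
    then have "n dvd 2 * m"
      by (simp add: cong_0_iff)
    moreover have "coprime n 2"
      using n_def by simp
    ultimately show False
      using assms coprime_dvd_mult_right_iff by blast
  qed
  ultimately have "{i, j} \<noteq> {k, l}" "card {i, j} = 2" "card {k, l} = 2"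
    using jl(3) by (auto simp: doubleton_eq_iff)
  moreover have "[i - j = k - l] (mod n)"
    using im km cong_sym cong_trans by blast
  ultimately show ?R
    using S km by blast
next
  assume ?R
  then obtain i j k l where S: "i \<in> S" "j \<in> S" "k \<in> S" "l \<in> S"
    and ne: "{i, j} \<noteq> {k, l}" and c: "[i - j = k - l] (mod n)" and km: "[k - l = m] (mod n)"
    unfolding insert_subset by blast
  have im: "[i - j = m] (mod n)"
    using c km cong_trans by blast
  have start: "(b + m) mod n = a" if "[a - b = m] (mod n)" "a \<in> S" for a b
    using cong_add[OF cong_refl[of b] that(1)] symbol_mod[OF that(2)] by (simp add: cong_def)
  have "{j, l} \<subseteq> diff_starts n S m"
    using start[OF im] start[OF km] S by (auto simp: diff_starts_def)
  \<comment> \<open>By \<open>start\<close>, the second entry determines the first, so j = l would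
    force i = k.\<close>
  moreover have "j \<noteq> l"
    using start[OF im] start[OF km] S ne by auto
  ultimately show "2 \<le> card (diff_starts n S m)"
    using card_mono[OF finite_diff_starts] by (metis card_2_iff)
qed

end

theorem theorem20:
  fixes r :: nat and n :: int and S :: "int set" and T :: "int pair_pre_digraph"
  assumes "n = 2 * int r + 1" and "n > 3"
    and "rotational_symbol r S"
    and "T = rotational_tournament r S"
  shows "quadrangular (with_proj T) \<longleftrightarrow>
    (\<forall>m::int. 1 \<le> m \<and> m \<le> (n - 1) div 2 \<longrightarrow>
      (\<exists>i j k l. {i, j} \<subseteq> S \<and> {k, l} \<subseteq> S \<and>
         card {i, j} = 2 \<and> card {k, l} = 2 \<and> {i, j} \<noteq> {k, l} \<and>
         [i - j = k - l] (mod n) \<and> [k - l = m] (mod n)))"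
proof -
  interpret rotational r n S
    using assms by unfold_locales
  \<comment> \<open>For n = 3 the equivalence fails: the directed triangle is quadrangular, but
    \<open>S\<close> has only one element.\<close>
  have r: "r > 1" "(n - 1) div 2 = int r"
    using assms by auto
  have "\<not> n dvd m" if "1 \<le> m \<and> m \<le> int r" for m
    using that n_def zdvd_imp_le by fastforce
  then show ?thesis
    unfolding assms(4) quadrangular_iff_card_ge_2[OF r(1)] r(2)
    using card_diff_starts_ge_2_iff by (simp cong: imp_cong)
qed

end
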